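(* Fix an interpretation of the language of fuzzy geometric logic with domain $D$, let $X$ be the set of all sequences (assignments) $s$ over $D$, and let $A$ be the set of all geometric formulae. Put $gr(s\models\phi)=gr(s\ \text{sat}\ \phi)$ and let $\phi\approx\psi$ iff $gr(s\models\phi)=gr(s\models\psi)$ for all $s\in X$. Then $(X,\models',A/_{\approx},R)$ is a graded fuzzy topological system, where $gr(s\models'[\phi])=gr(s\models\phi)$ and $R([\phi],[\psi])=\inf_s\{gr(s\models'[\phi])\to gr(s\models'[\psi])\}$, with $\to$ the Gödel arrow.
   Context: Language: countably many individual constants $c_i$, denumerably many variables $x_1,x_2,\dots$, propositional constants $\top,\bot$, for each $i>0$ countably many $i$-place predicate symbols $p^i_j$ (including 2-place identity "$=$") and countably many $i$-place function symbols $f^i_j$. Terms are built from constants and variables by function symbols. Geometric formulae: $\top$, $\bot$, $p^i_jt_1\dots t_i$, $(t_i=t_j)$ for terms; $(\phi\wedge\psi)$; $\bigvee\{\phi_i\}_{i\in I}$ for any family of geometric formulae (for a two-element index set written $\phi_1\vee\phi_2$); $\exists x_i\phi$; nothing else. An interpretation $I$ consists of a set $D$, elements $I(c_i)\in D$, functions $I(f^i_j):D^i\to D$ and fuzzy relations $I(p^i_j):D^i\to[0,1]$. For a sequence $s=(s_1,s_2,\dots)$ over $D$ and $d\in D$, $s(d/x_i)$ is $s$ with its $i$-th coordinate replaced by $d$; $s(c_i)=I(c_i)$, $s(x_i)=s_i$, $s(f^i_jt_1\dots t_i)=I(f^i_j)(s(t_1),\dots,s(t_i))$. The grade $gr(s\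 \text{sat}\ \phi)\in[0,1]$ is: $gr(s\ \text{sat}\ p^i_jt_1\dots t_i)=I(p^i_j)(s(t_1),\dots,s(t_i))$; $gr(s\ \text{sat}\ \top)=1$; $gr(s\ \text{sat}\ \bot)=0$; $gr(s\ \text{sat}\ t_i=t_j)=1$ if $s(t_i)=s(t_j)$ and $0$ otherwise; $gr(s\ \text{sat}\ \phi_1\wedge\phi_2)=\min$ of the two grades; $gr(s\ \text{sat}\ \bigvee\{\phi_i\}_{i\in I})=\sup_{i}gr(s\ \text{sat}\ \phi_i)$; $gr(s\ \text{sat}\ \exists x_i\phi)=\sup_{d\in D}gr(s(d/x_i)\ \text{sat}\ \phi)$. Operations on $A/_{\approx}$: top $[\top]$, $[\phi]\wedge[\psi]=[\phi\wedge\psi]$, $\bigvee\{[\phi_i]\}_i=[\bigvee\{\phi_i\}_i]$. Gödel arrow: $a\to b=1$ if $a\le b$, $a\to b=b$ if $a>b$ ($a,b\in[0,1]$). In $[0,1]$, $\wedge$ is minimum. A graded frame $(A,R)$ is a 5-tuple $(A,\top,\wedge,\bigvee,R)$ with $A$ a non-empty set, $\top\in A$, $\wedge$ a binary operation, $\bigvee$ an operation on arbitrary subsets of $A$, and $R:A\times A\to[0,1]$ such that for all $a,b,c\in A$, $S\subseteq A$: (1) $R(a,a)=1$; (2) $R(a,b)=1=R(b,a)$ implies $a=b$; (3) $R(a,b)\wedge R(b,c)\le R(a,c)$; (4) $R(a\wedge b,a)=1=R(a\wedge b,b)$; (5) $R(a,\top)=1$; (6) $R(a,b)\wedge R(a,c)=R(a,b\wedge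 c)$; (7) $R(a,\bigvee S)=1$ if $a\in S$; (8) $\inf\{R(a,b)\mid a\in S\}=R(\bigvee S,b)$; (9) $R(a\wedge\bigvee S,\bigvee\{a\wedge b\mid b\in S\})=1$. A graded fuzzy topological system is $(X,\models,A,R)$ with $X$ a non-empty set, $(A,R)$ a graded frame and $\models$ a function $(x,a)\mapsto gr(x\models a)\in[0,1]$ such that (1) $gr(x\models a)\wedge R(a,b)\le gr(x\models b)$; (2) $gr(x\models\bigwedge S)=\inf\{gr(x\models a)\mid a\in S\}$ for finite $S\subseteq A$, including $S=\emptyset$ (where $\bigwedge\emptyset=\top$, $\inf\emptyset=1$); (3) $gr(x\models\bigvee S)=\sup\{gr(x\models a)\mid a\in S\}$ for every $S\subseteq A$ (with $\sup\emptyset=0$).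
   Formalization: Disjunctions over any family would make the geometric formulae a proper class, so families are indexed by subsets of an arbitrary fixed set with at least continuum many elements; the domain D is taken non-empty, since X must be non-empty. *)

theory Defs
  imports Complex_Main "HOL-Library.FuncSet" "HOL-Library.Equipollence"
begin

section \<open>The unit interval as a lattice\<close>

text \<open>Grades are reals in the unit interval. Inserting the bounds changes nothing for a non-empty
  set of grades, and makes the supremum of the empty set 0 and its infimum 1.\<close>

definition sup01 :: "real set \<Rightarrow> real" where
  "sup01 S = Sup (insert 0 S)"

definition inf01 :: "real set \<Rightarrow> real" where
  "inf01 S = Inf (insert 1 S)"

definition godel_arrow :: "real \<Rightarrow> real \<Rightarrow> real" where
  "godel_arrow a b = (if a \<le> b then 1 else b)"

lemma sup01_least_upper_bound:
  assumes "S \<subseteq> {0..1}"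
  shows "sup01 S \<in> {0..1}" "\<And>x. x \<in> S \<Longrightarrow> x \<le> sup01 S"
    "\<And>u. u \<in> {0..1} \<Longrightarrow> (\<And>x. x \<in> S \<Longrightarrow> x \<le> u) \<Longrightarrow> sup01 S \<le> u"
proof -
  have bdd: "bdd_above (insert 0 S)"
    using assms by (intro bdd_aboveI[where M = 1]) auto
  show "\<And>x. x \<in> S \<Longrightarrow> x \<le> sup01 S"
    unfolding sup01_def using bdd by (intro cSup_upper) auto
  have "0 \<le> sup01 S"
    unfolding sup01_def using bdd by (intro cSup_upper) auto
  moreover show least: "\<And>u. u \<in> {0..1} \<Longrightarrow> (\<And>x. x \<in> S \<Longrightarrow> x \<le> u) \<Longrightarrow> sup01 S \<le> u"
    unfolding sup01_def by (intro cSup_least) auto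
  have "sup01 S \<le> 1"
    using assms by (intro least) auto
  ultimately show "sup01 S \<in> {0..1}" by simp
qed

lemma inf01_greatest_lower_bound:
  assumes "S \<subseteq> {0..1}"
  shows "inf01 S \<in> {0..1}" "\<And>x. x \<in> S \<Longrightarrow> inf01 S \<le> x"
    "\<And>l. l \<in> {0..1} \<Longrightarrow> (\<And>x. x \<in> S \<Longrightarrow> l \<le> x) \<Longrightarrow> l \<le> inf01 S"
proof -
  have bdd: "bdd_below (insert 1 S)"
    using assms by (intro bdd_belowI[where m = 0]) auto
  show "\<And>x. x \<in> S \<Longrightarrow> inf01 S \<le> x"
    unfolding inf01_def using bdd by (intro cInf_lower) auto
  have "inf01 S \<le> 1"
    unfolding inf01_def using bdd by (intro cInf_lower) auto
  moreover show greatest: "\<And>l. l \<in> {0..1} \<Longrightarrow> (\<And>x. x \<in> S \<Longrightarrow> l \<le> x) \<Longrightarrow> l \<le> inf01 S"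
    unfolding inf01_def by (intro cInf_greatest) auto
  have "0 \<le> inf01 S"
    using assms by (intro greatest) auto
  ultimately show "inf01 S \<in> {0..1}" by simp
qed


section \<open>Graded frames and graded fuzzy topological systems\<close>

locale graded_frame =
  fixes A :: "'a set"
    and tp :: 'a
    and meet :: "'a \<Rightarrow> 'a \<Rightarrow> 'a"
    and Join :: "'a set \<Rightarrow> 'a"
    and R :: "'a \<Rightarrow> 'a \<Rightarrow> real"
  assumes nonempty: "A \<noteq> {}"
    and tp_closed: "tp \<in> A"
    and meet_closed: "\<And>a b. a \<in> A \<Longrightarrow> b \<in> A \<Longrightarrow> meet a b \<in> A"
    and Join_closed: "\<And>S. S \<subseteq> A \<Longrightarrow> Join S \<in> A"
    and R_range: "\<And>a b. a \<in> A \<Longrightarrow> b \<in> A \<Longrightarrow> R a b \<in> {0..1}"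
    and R_refl: "\<And>a. a \<in> A \<Longrightarrow> R a a = 1"
    and R_antisym: "\<And>a b. a \<in> A \<Longrightarrow> b \<in> A \<Longrightarrow> R a b = 1 \<Longrightarrow> R b a = 1 \<Longrightarrow> a = b"
    and R_trans: "\<And>a b c. a \<in> A \<Longrightarrow> b \<in> A \<Longrightarrow> c \<in> A \<Longrightarrow> min (R a b) (R b c) \<le> R a c"
    and R_meet_left: "\<And>a b. a \<in> A \<Longrightarrow> b \<in> A \<Longrightarrow> R (meet a b) a = 1"
    and R_meet_right: "\<And>a b. a \<in> A \<Longrightarrow> b \<in> A \<Longrightarrow> R (meet a b) b = 1"
    and R_tp: "\<And>a. a \<in> A \<Longrightarrow> R a tp = 1"
    and R_meet: "\<And>a b c. a \<in> A \<Longrightarrow> b \<in> A \<Longrightarrow> c \<in> A \<Longrightarrow> min (R a b) (R a c) = R a (meet b c)"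
    and R_Join_upper: "\<And>S a. S \<subseteq> A \<Longrightarrow> a \<in> S \<Longrightarrow> R a (Join S) = 1"
    and R_Join: "\<And>S b. S \<subseteq> A \<Longrightarrow> b \<in> A \<Longrightarrow> inf01 ((\<lambda>a. R a b) ` S) = R (Join S) b"
    and R_distrib: "\<And>a S. a \<in> A \<Longrightarrow> S \<subseteq> A \<Longrightarrow> R (meet a (Join S)) (Join (meet a ` S)) = 1"

text \<open>The meet of a finite set is the iterated binary meet, starting from the top element; the
  frame axioms make it independent of the order of iteration.\<close>

definition finite_meet :: "'a \<Rightarrow> ('a \<Rightarrow> 'a \<Rightarrow> 'a) \<Rightarrow> 'a set \<Rightarrow> 'a" where
  "finite_meet tp meet S = Finite_Set.fold meet tp S"

locale graded_fuzzy_topological_system = graded_frame A tp meet Join R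
  for X :: "'x set"
    and gr :: "'x \<Rightarrow> 'a \<Rightarrow> real"
    and A :: "'a set"
    and tp :: 'a
    and meet :: "'a \<Rightarrow> 'a \<Rightarrow> 'a"
    and Join :: "'a set \<Rightarrow> 'a"
    and R :: "'a \<Rightarrow> 'a \<Rightarrow> real" +
  assumes X_nonempty: "X \<noteq> {}"
    and gr_range: "\<And>x a. x \<in> X \<Longrightarrow> a \<in> A \<Longrightarrow> gr x a \<in> {0..1}"
    and gr_R: "\<And>x a b. x \<in> X \<Longrightarrow> a \<in> A \<Longrightarrow> b \<in> A \<Longrightarrow> min (gr x a) (R a b) \<le> gr x b"
    and gr_finite_meet: "\<And>x S. x \<in> X \<Longrightarrow> finite S \<Longrightarrow> S \<subseteq> A \<Longrightarrow>
      gr x (finite_meet tp meet S) = inf01 (gr x ` S)"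
    and gr_Join: "\<And>x S. x \<in> X \<Longrightarrow> S \<subseteq> A \<Longrightarrow> gr x (Join S) = sup01 (gr x ` S)"


section \<open>Syntax of fuzzy geometric logic\<close>

text \<open>A language chooses, among denumerably many candidates, the indices of its individual
  constants and, for each arity, of its function and predicate symbols; hence there are at most
  countably many of each. Arity 0 is excluded in the formation rules. Identity has its own
  constructor, as its interpretation is fixed.\<close>

record language =
  consts_of :: "nat set"
  funs_of :: "nat \<Rightarrow> nat set"
  preds_of :: "nat \<Rightarrow> nat set"

text \<open>In \<open>Fn i j ts\<close> and \<open>Pred i j ts\<close>, \<open>i\<close> is the arity and \<open>j\<close> the index of the symbol.\<close>

datatype tm = Const nat | Var nat | Fn nat nat "tm list"

inductive_set terms :: "language \<Rightarrow> tm set" for L :: language where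
  "c \<in> consts_of L \<Longrightarrow> Const c \<in> terms L"
| "Var n \<in> terms L"
| "0 < i \<Longrightarrow> j \<in> funs_of L i \<Longrightarrow> length ts = i \<Longrightarrow> (\<And>t. t \<in> set ts \<Longrightarrow> t \<in> terms L) \<Longrightarrow>
    Fn i j ts \<in> terms L"

text \<open>Families of formulae in a disjunction are indexed by arbitrary subsets of the type \<open>'k\<close>, as a
  datatype cannot admit families of unbounded cardinality.\<close>

datatype 'k fm =
    Top
  | Bot
  | Pred nat nat "tm list"
  | Eq tm tm
  | And "'k fm" "'k fm"
  | Disj "'k set" "'k \<Rightarrow> 'k fm"
  | Ex nat "'k fm"

text \<open>Extensionality makes \<open>F\<close> in \<open>Disj I F\<close> carry no information beyond the family over \<open>I\<close>.\<close>

inductive_set formulae :: "language \<Rightarrow> 'k fm set" for L :: language where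
  "Top \<in> formulae L"
| "Bot \<in> formulae L"
| "0 < i \<Longrightarrow> j \<in> preds_of L i \<Longrightarrow> length ts = i \<Longrightarrow> set ts \<subseteq> terms L \<Longrightarrow> Pred i j ts \<in> formulae L"
| "t \<in> terms L \<Longrightarrow> u \<in> terms L \<Longrightarrow> Eq t u \<in> formulae L"
| "\<phi> \<in> formulae L \<Longrightarrow> \<psi> \<in> formulae L \<Longrightarrow> And \<phi> \<psi> \<in> formulae L"
| "F \<in> extensional I \<Longrightarrow> (\<And>k. k \<in> I \<Longrightarrow> F k \<in> formulae L) \<Longrightarrow> Disj I F \<in> formulae L"
| "\<phi> \<in> formulae L \<Longrightarrow> Ex n \<phi> \<in> formulae L"


section \<open>Semantics\<close>

text \<open>Elements of the \<open>i\<close>-th power of the domain are lists of length \<open>i\<close>.\<close>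

record 'd interp =
  Dom :: "'d set"
  const_val :: "nat \<Rightarrow> 'd"
  fun_val :: "nat \<Rightarrow> nat \<Rightarrow> 'd list \<Rightarrow> 'd"
  pred_val :: "nat \<Rightarrow> nat \<Rightarrow> 'd list \<Rightarrow> real"

definition is_interpretation :: "language \<Rightarrow> 'd interp \<Rightarrow> bool" where
  "is_interpretation L J \<longleftrightarrow>
     Dom J \<noteq> {} \<and>
     (\<forall>c \<in> consts_of L. const_val J c \<in> Dom J) \<and>
     (\<forall>i > 0. \<forall>j \<in> funs_of L i. \<forall>ds. length ds = i \<longrightarrow> set ds \<subseteq> Dom J \<longrightarrow>
        fun_val J i j ds \<in> Dom J) \<and>
     (\<forall>i > 0. \<forall>j \<in> preds_of L i. \<forall>ds. length ds = i \<longrightarrow> set ds \<subseteq> Dom J \<longrightarrow>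
        pred_val J i j ds \<in> {0..1})"

definition assignments :: "'d interp \<Rightarrow> (nat \<Rightarrow> 'd) set" where
  "assignments J = {s. \<forall>n. s n \<in> Dom J}"

primrec tm_val :: "'d interp \<Rightarrow> (nat \<Rightarrow> 'd) \<Rightarrow> tm \<Rightarrow> 'd" where
  "tm_val J s (Const c) = const_val J c"
| "tm_val J s (Var n) = s n"
| "tm_val J s (Fn i j ts) = fun_val J i j (map (tm_val J s) ts)"

primrec grade :: "'d interp \<Rightarrow> 'k fm \<Rightarrow> (nat \<Rightarrow> 'd) \<Rightarrow> real" where
  "grade J Top s = 1"
| "grade J Bot s = 0"
| "grade J (Pred i j ts) s = pred_val J i j (map (tm_val J s) ts)"
| "grade J (Eq t u) s = (if tm_val J s t = tm_val J s u then 1 else 0)"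
| "grade J (And \<phi> \<psi>) s = min (grade J \<phi> s) (grade J \<psi> s)"
| "grade J (Disj I F) s = sup01 ((\<lambda>k. grade J (F k) s) ` I)"
| "grade J (Ex n \<phi>) s = sup01 ((\<lambda>d. grade J \<phi> (s(n := d))) ` Dom J)"


section \<open>The quotient by semantic equivalence\<close>

definition fm_equiv :: "language \<Rightarrow> 'd interp \<Rightarrow> ('k fm \<times> 'k fm) set" where
  "fm_equiv L J = {(\<phi>, \<psi>). \<phi> \<in> formulae L \<and> \<psi> \<in> formulae L \<and>
     (\<forall>s \<in> assignments J. grade J \<phi> s = grade J \<psi> s)}"

definition fm_class :: "language \<Rightarrow> 'd interp \<Rightarrow> 'k fm \<Rightarrow> 'k fm set" where
  "fm_class L J \<phi> = fm_equiv L J `` {\<phi>}"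

definition fm_quotient :: "language \<Rightarrow> 'd interp \<Rightarrow> 'k fm set set" where
  "fm_quotient L J = formulae L // fm_equiv L J"

text \<open>The operations on classes are unions over representatives of classes that all coincide; the
  lemmas below give the resulting equations.\<close>

definition class_meet :: "language \<Rightarrow> 'd interp \<Rightarrow> 'k fm set \<Rightarrow> 'k fm set \<Rightarrow> 'k fm set" where
  "class_meet L J a b = (\<Union>\<phi> \<in> a. \<Union>\<psi> \<in> b. fm_class L J (And \<phi> \<psi>))"

definition class_Join :: "language \<Rightarrow> 'd interp \<Rightarrow> 'k fm set set \<Rightarrow> 'k fm set" where
  "class_Join L J S =
     \<Union>{fm_class L J (Disj I F) | I F. F \<in> I \<rightarrow>\<^sub>E formulae L \<and> (\<lambda>k. fm_class L J (F k)) ` I = S}"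

definition class_grade :: "'d interp \<Rightarrow> (nat \<Rightarrow> 'd) \<Rightarrow> 'k fm set \<Rightarrow> real" where
  "class_grade J s a = (THE r. \<exists>\<phi> \<in> a. r = grade J \<phi> s)"

definition class_R :: "'d interp \<Rightarrow> 'k fm set \<Rightarrow> 'k fm set \<Rightarrow> real" where
  "class_R J a b =
     inf01 ((\<lambda>s. godel_arrow (class_grade J s a) (class_grade J s b)) ` assignments J)"

lemma equiv_fm_equiv: "equiv (formulae L) (fm_equiv L J)"
  unfolding fm_equiv_def by (rule equivI) (auto simp: refl_on_def sym_def trans_def)

lemma fm_class_eq_iff:
  assumes "\<phi> \<in> formulae L" "\<psi> \<in> formulae L"
  shows "fm_class L J \<phi> = fm_class L J \<psi> \<longleftrightarrow> (\<forall>s \<in> assignments J. grade J \<phi> s = grade J \<psi> s)"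
  using eq_equiv_class_iff[OF equiv_fm_equiv assms] assms
  by (simp add: fm_class_def fm_equiv_def)

lemma mem_fm_class_iff:
  assumes "\<phi> \<in> formulae L"
  shows "\<chi> \<in> fm_class L J \<phi> \<longleftrightarrow>
    \<chi> \<in> formulae L \<and> (\<forall>s \<in> assignments J. grade J \<phi> s = grade J \<chi> s)"
  using assms by (simp add: fm_class_def fm_equiv_def)

lemma class_meet_fm_class:
  assumes "\<phi> \<in> formulae L" "\<psi> \<in> formulae L"
  shows "class_meet L J (fm_class L J \<phi>) (fm_class L J \<psi>) = fm_class L J (And \<phi> \<psi>)"
proof -
  have eq: "fm_class L J (And \<phi>' \<psi>') = fm_class L J (And \<phi> \<psi>)"
    if \<phi>': "\<phi>' \<in> fm_class L J \<phi>" and \<psi>': "\<psi>' \<in> fm_class L J \<psi>" for \<phi>' \<psi>'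
  proof -
    have *: "\<phi>' \<in> formulae L" "\<psi>' \<in> formulae L"
      "\<forall>s \<in> assignments J. grade J \<phi> s = grade J \<phi>' s"
      "\<forall>s \<in> assignments J. grade J \<psi> s = grade J \<psi>' s"
      using \<phi>'[unfolded mem_fm_class_iff[OF assms(1)]] \<psi>'[unfolded mem_fm_class_iff[OF assms(2)]]
      by blast+
    show ?thesis
      by (rule fm_class_eq_iff[THEN iffD2, OF formulae.intros(5)[OF *(1,2)] formulae.intros(5)[OF assms]])
        (simp add: *(3,4))
  qed
  have "\<phi> \<in> fm_class L J \<phi>" "\<psi> \<in> fm_class L J \<psi>"
    using assms by (simp_all add: mem_fm_class_iff)
  then have "fm_class L J \<phi> \<noteq> {}" "fm_class L J \<psi> \<noteq> {}"
    by (metis emptyE)+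
  moreover have "class_meet L J (fm_class L J \<phi>) (fm_class L J \<psi>) =
      (\<Union>\<phi>' \<in> fm_class L J \<phi>. \<Union>\<psi>' \<in> fm_class L J \<psi>. fm_class L J (And \<phi> \<psi>))"
    unfolding class_meet_def by (intro SUP_cong refl eq)
  ultimately show ?thesis by (simp only: UN_constant if_False)
qed

lemma Disj_in_formulae: "F \<in> I \<rightarrow>\<^sub>E formulae L \<Longrightarrow> Disj I F \<in> formulae L"
  by (intro formulae.intros(6)) (simp_all add: PiE_iff)

lemma class_Join_fm_class:
  fixes F :: "'k \<Rightarrow> 'k fm"
  assumes F: "F \<in> I \<rightarrow>\<^sub>E formulae L"
  shows "class_Join L J ((\<lambda>k. fm_class L J (F k)) ` I) = fm_class L J (Disj I F)"
proof -
  have "fm_class L J (Disj I' F') = fm_class L J (Disj I F)"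
    if F': "F' \<in> I' \<rightarrow>\<^sub>E formulae L"
      and eq: "(\<lambda>k. fm_class L J (F' k)) ` I' = (\<lambda>k. fm_class L J (F k)) ` I" for I' F'
  proof -
    have "(\<lambda>k. grade J (F1 k) s) ` I1 \<subseteq> (\<lambda>k. grade J (F2 k) s) ` I2"
      if s: "s \<in> assignments J" and F1: "F1 \<in> I1 \<rightarrow>\<^sub>E formulae L" and F2: "F2 \<in> I2 \<rightarrow>\<^sub>E formulae L"
        and sub: "(\<lambda>k. fm_class L J (F1 k)) ` I1 \<subseteq> (\<lambda>k. fm_class L J (F2 k)) ` I2"
      for s I1 I2 and F1 F2 :: "'k \<Rightarrow> 'k fm"
    proof clarify
      fix k assume k: "k \<in> I1"
      then obtain l where l: "l \<in> I2" "fm_class L J (F1 k) = fm_class L J (F2 l)"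
        using sub by blast
      have "F1 k \<in> formulae L" "F2 l \<in> formulae L"
        using k l(1) F1 F2 by (auto simp: PiE_iff)
      with l(2) s have "grade J (F1 k) s = grade J (F2 l) s"
        by (simp add: fm_class_eq_iff)
      with l(1) show "grade J (F1 k) s \<in> (\<lambda>k. grade J (F2 k) s) ` I2"
        by auto
    qed
    from this[OF _ F' F] this[OF _ F F'] eq
    have "(\<lambda>k. grade J (F' k) s) ` I' = (\<lambda>k. grade J (F k) s) ` I" if "s \<in> assignments J" for s
      using that by (simp add: subset_antisym)
    then show ?thesis
      using F F' by (intro fm_class_eq_iff[THEN iffD2] Disj_in_formulae) simp_all
  qed
  then have "{fm_class L J (Disj I' F') | I' F'. F' \<in> I' \<rightarrow>\<^sub>E formulae L \<and>
      (\<lambda>k. fm_class L J (F' k)) ` I' = (\<lambda>k. fm_class L J (F k)) ` I} = {fm_class L J (Disj I F)}"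
    (is "?C = _")
  proof (intro equalityI subsetI)
    fix c assume "c \<in> {fm_class L J (Disj I F)}"
    then have "c = fm_class L J (Disj I F)" by simp
    with F show "c \<in> ?C" by (intro CollectI exI[of _ I] exI[of _ F] conjI refl)
  qed auto
  then show ?thesis
    unfolding class_Join_def by simp
qed

lemma class_grade_fm_class:
  assumes "\<phi> \<in> formulae L" "s \<in> assignments J"
  shows "class_grade J s (fm_class L J \<phi>) = grade J \<phi> s"
  unfolding class_grade_def using assms
  by (intro the_equality) (auto simp: mem_fm_class_iff)

lemma class_R_fm_class:
  assumes "\<phi> \<in> formulae L" "\<psi> \<in> formulae L"
  shows "class_R J (fm_class L J \<phi>) (fm_class L J \<psi>) =
    inf01 ((\<lambda>s. godel_arrow (grade J \<phi> s) (grade J \<psi> s)) ` assignments J)"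
  unfolding class_R_def using assms
  by (intro arg_cong[where f = inf01] image_cong) (auto simp: class_grade_fm_class)

end

theory Submission
  imports Defs "HOL-Library.Countable"
begin

text \<open>
  There are two ingredients.

  \<^item> The order-theoretic one is soft. Whenever points evaluate the elements of a set
    in the unit interval, the evaluations separate the elements, and top, binary meets and arbitrary
    joins are evaluated as 1, minimum and supremum, the infimum of the pointwise Goedel arrows makes
    the set a graded frame and the evaluation a graded fuzzy topological system
    (\<open>graded_system_of_separating_evaluation\<close>). The Goedel arrow is the residual of the
    minimum, so a grade \<open>c\<close> is below \<open>R a b\<close> iff \<open>min c (gr x a) \<le> gr x b\<close> at every point
    \<open>x\<close>, and each axiom becomes an inequality between grades at one point.

  \<^item> The other one is the existence of all joins. A disjunction ranges over a
    family indexed by a subset of \<open>'k\<close>, whereas the join of an arbitrary set of classes is wanted, so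
    there must be no more classes than elements of \<open>'k\<close>, although the domain of the interpretation
    may be arbitrarily large. In the unit interval the minimum distributes over suprema, and suprema
    commute with each other; hence disjunctions can be moved outwards through conjunctions and
    existential quantifiers, and every geometric formula has the grade of a disjunction of formulae
    free of disjunctions (\<open>grade_eq_sup_of_finitary\<close>). There are only countably many of the latter,
    so there are at most continuum many classes (\<open>fm_quotient_lepoll_continuum\<close>), and \<open>'k\<close> has at
    least that many elements.
\<close>

section \<open>Suprema, infima and the Goedel arrow in the unit interval\<close>

lemma sup01_le_iff:
  assumes "S \<subseteq> {0..1}"
  shows "sup01 S \<le> u \<longleftrightarrow> 0 \<le> u \<and> (\<forall>x\<in>S. x \<le> u)"
proof
  assume "sup01 S \<le> u"
  then show "0 \<le> u \<and> (\<forall>x\<in>S. x \<le> u)"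
    using sup01_least_upper_bound(1,2)[OF assms] by force
next
  assume u: "0 \<le> u \<and> (\<forall>x\<in>S. x \<le> u)"
  have "sup01 S \<le> min 1 u"
    using u assms by (intro sup01_least_upper_bound(3)[OF assms]) auto
  then show "sup01 S \<le> u" by simp
qed

lemma le_inf01_iff:
  assumes "S \<subseteq> {0..1}"
  shows "l \<le> inf01 S \<longleftrightarrow> l \<le> 1 \<and> (\<forall>x\<in>S. l \<le> x)"
proof
  assume "l \<le> inf01 S"
  then show "l \<le> 1 \<and> (\<forall>x\<in>S. l \<le> x)"
    using inf01_greatest_lower_bound(1,2)[OF assms] by force
next
  assume l: "l \<le> 1 \<and> (\<forall>x\<in>S. l \<le> x)"
  have "max 0 l \<le> inf01 S"
    using l assms by (intro inf01_greatest_lower_bound(3)[OF assms]) auto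
  then show "l \<le> inf01 S" by simp
qed

lemma inf01_insert:
  assumes "x \<in> {0..1}" "S \<subseteq> {0..1}"
  shows "inf01 (insert x S) = min x (inf01 S)"
proof (rule antisym)
  have ins: "insert x S \<subseteq> {0..1}" using assms by simp
  show "inf01 (insert x S) \<le> min x (inf01 S)"
    using le_inf01_iff[OF ins, of "inf01 (insert x S)"] by (simp add: le_inf01_iff[OF assms(2)])
  show "min x (inf01 S) \<le> inf01 (insert x S)"
    using le_inf01_iff[OF assms(2), of "inf01 S"] assms(1)
    by (subst le_inf01_iff[OF ins]) (auto simp: min_le_iff_disj)
qed

lemma min_sup01:
  assumes "c \<in> {0..1}" "S \<subseteq> {0..1}"
  shows "min c (sup01 S) = sup01 (min c ` S)"
proof (rule antisym)
  have img: "min c ` S \<subseteq> {0..1}" using assms by (auto simp: min_def)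
  show "sup01 (min c ` S) \<le> min c (sup01 S)"
    using assms(1) sup01_least_upper_bound(1,2)[OF assms(2)]
    by (subst sup01_le_iff[OF img]) (auto simp: min_le_iff_disj)
  have *: "0 \<le> sup01 (min c ` S)" "x \<in> S \<Longrightarrow> min c x \<le> sup01 (min c ` S)" for x
    using sup01_least_upper_bound(1,2)[OF img] by auto
  show "min c (sup01 S) \<le> sup01 (min c ` S)"
  proof (cases "c \<le> sup01 (min c ` S)")
    case False
    then have "sup01 S \<le> sup01 (min c ` S)"
      using * by (subst sup01_le_iff[OF assms(2)]) (fastforce simp: min_le_iff_disj)
    then show ?thesis by (simp add: min_le_iff_disj)
  qed (simp add: min_le_iff_disj)
qed

lemma sup01_sup01_UN:
  assumes "\<And>i f. i \<in> I \<Longrightarrow> f \<in> T i \<Longrightarrow> h f \<in> {0..1}"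
  shows "sup01 ((\<lambda>i. sup01 (h ` T i)) ` I) = sup01 (h ` (\<Union>i\<in>I. T i))"
proof -
  have T: "h ` T i \<subseteq> {0..1}" if "i \<in> I" for i using assms that by auto
  then have I: "(\<lambda>i. sup01 (h ` T i)) ` I \<subseteq> {0..1}"
    using sup01_least_upper_bound(1) by (intro image_subsetI) blast
  have U: "h ` (\<Union>i\<in>I. T i) \<subseteq> {0..1}" using assms by auto
  have "sup01 ((\<lambda>i. sup01 (h ` T i)) ` I) \<le> u \<longleftrightarrow> sup01 (h ` (\<Union>i\<in>I. T i)) \<le> u" for u
    by (simp add: sup01_le_iff[OF I] sup01_le_iff[OF U] sup01_le_iff[OF T] cong: ball_cong) blast
  then show ?thesis by (meson order.refl antisym)
qed

lemma sup01_commute: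
  assumes "\<And>i j. i \<in> I \<Longrightarrow> j \<in> K \<Longrightarrow> h i j \<in> {0..1}"
  shows "sup01 ((\<lambda>i. sup01 (h i ` K)) ` I) = sup01 ((\<lambda>j. sup01 ((\<lambda>i. h i j) ` I)) ` K)"
proof -
  have K: "h i ` K \<subseteq> {0..1}" if "i \<in> I" for i using assms that by auto
  then have IK: "(\<lambda>i. sup01 (h i ` K)) ` I \<subseteq> {0..1}"
    using sup01_least_upper_bound(1) by (intro image_subsetI) blast
  have I: "(\<lambda>i. h i j) ` I \<subseteq> {0..1}" if "j \<in> K" for j using assms that by auto
  then have KI: "(\<lambda>j. sup01 ((\<lambda>i. h i j) ` I)) ` K \<subseteq> {0..1}"
    using sup01_least_upper_bound(1) by (intro image_subsetI) blast
  have "sup01 ((\<lambda>i. sup01 (h i ` K)) ` I) \<le> u \<longleftrightarrow>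
      sup01 ((\<lambda>j. sup01 ((\<lambda>i. h i j) ` I)) ` K) \<le> u" for u
    by (simp add: sup01_le_iff[OF IK] sup01_le_iff[OF KI] sup01_le_iff[OF K] sup01_le_iff[OF I]
        cong: ball_cong) blast
  then show ?thesis by (meson order.refl antisym)
qed

lemma godel_arrow_range: "b \<in> {0..1} \<Longrightarrow> godel_arrow a b \<in> {0..1}"
  by (simp add: godel_arrow_def)

lemma le_godel_arrow_iff: "c \<le> 1 \<Longrightarrow> c \<le> godel_arrow a b \<longleftrightarrow> min c a \<le> b"
  by (auto simp: godel_arrow_def min_le_iff_disj)


section \<open>Graded systems from evaluations in the unit interval\<close>

text \<open>By separation, an identity between elements of \<open>A\<close> can be checked at the points. This makes the
  meet commutative and associative, so that finite meets may be computed one element at a time;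
  it also gives antisymmetry of \<open>R\<close>. Everything else is residuation at a single point.\<close>

lemma graded_system_of_separating_evaluation:
  fixes gr :: "'x \<Rightarrow> 'a \<Rightarrow> real"
  assumes X: "X \<noteq> {}"
    and range: "\<And>x a. x \<in> X \<Longrightarrow> a \<in> A \<Longrightarrow> gr x a \<in> {0..1}"
    and separating: "\<And>a b. a \<in> A \<Longrightarrow> b \<in> A \<Longrightarrow> (\<And>x. x \<in> X \<Longrightarrow> gr x a = gr x b) \<Longrightarrow> a = b"
    and tp: "tp \<in> A" "\<And>x. x \<in> X \<Longrightarrow> gr x tp = 1"
    and meet: "\<And>a b. a \<in> A \<Longrightarrow> b \<in> A \<Longrightarrow> meet a b \<in> A"
      "\<And>x a b. x \<in> X \<Longrightarrow> a \<in> A \<Longrightarrow> b \<in> A \<Longrightarrow> gr x (meet a b) = min (gr x a) (gr x b)"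
    and Join: "\<And>S. S \<subseteq> A \<Longrightarrow> Join S \<in> A"
      "\<And>x S. x \<in> X \<Longrightarrow> S \<subseteq> A \<Longrightarrow> gr x (Join S) = sup01 (gr x ` S)"
    and R: "\<And>a b. a \<in> A \<Longrightarrow> b \<in> A \<Longrightarrow>
      R a b = inf01 ((\<lambda>x. godel_arrow (gr x a) (gr x b)) ` X)"
  shows "graded_fuzzy_topological_system X gr A tp meet Join R"
proof -
  have arrows: "(\<lambda>x. godel_arrow (gr x a) (gr x b)) ` X \<subseteq> {0..1}" if "b \<in> A" for a b
    using range that godel_arrow_range by blast
  have R_range: "R a b \<in> {0..1}" if "a \<in> A" "b \<in> A" for a b
    using inf01_greatest_lower_bound(1)[OF arrows] that by (simp add: R)
  have le_R: "c \<le> R a b \<longleftrightarrow> c \<le> 1 \<and> (\<forall>x\<in>X. min c (gr x a) \<le> gr x b)"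
    if "a \<in> A" "b \<in> A" for a b c
    using that by (auto simp: R le_inf01_iff[OF arrows] le_godel_arrow_iff)
  have R_point: "min (R a b) (gr x a) \<le> gr x b" if "x \<in> X" "a \<in> A" "b \<in> A" for x a b
    using le_R[of a b "R a b"] that by simp
  have R_one: "R a b = 1 \<longleftrightarrow> (\<forall>x\<in>X. gr x a \<le> gr x b)" if "a \<in> A" "b \<in> A" for a b
  proof -
    have "R a b = 1 \<longleftrightarrow> 1 \<le> R a b" using R_range[OF that] by auto
    also have "\<dots> \<longleftrightarrow> (\<forall>x\<in>X. gr x a \<le> gr x b)"
      using range that by (simp add: le_R)
    finally show ?thesis .
  qed
  have grS: "gr x ` S \<subseteq> {0..1}" if "x \<in> X" "S \<subseteq> A" for x S
    using range that by blast
  have meet_left_commute: "meet a (meet b c) = meet b (meet a c)"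
    if "a \<in> A" "b \<in> A" "c \<in> A" for a b c
    using that by (intro separating) (simp_all add: meet min.left_commute)
  show ?thesis
  proof
    show "A \<noteq> {}" using tp by blast
    show "tp \<in> A" by (fact tp)
    show "meet a b \<in> A" if "a \<in> A" "b \<in> A" for a b using that by (fact meet)
    show "Join S \<in> A" if "S \<subseteq> A" for S using that by (fact Join)
    show "R a b \<in> {0..1}" if "a \<in> A" "b \<in> A" for a b using that by (fact R_range)
    show "R a a = 1" if "a \<in> A" for a using that by (simp add: R_one)
    show "a = b" if "a \<in> A" "b \<in> A" "R a b = 1" "R b a = 1" for a b
      using that by (intro separating) (auto simp: R_one intro: antisym)
    show "min (R a b) (R b c) \<le> R a c" if "a \<in> A" "b \<in> A" "c \<in> A" for a b c
    proof (subst le_R[OF that(1,3)], intro conjI ballI)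
      show "min (R a b) (R b c) \<le> 1" using R_range[of a b] that by auto
      fix x assume "x \<in> X"
      then show "min (min (R a b) (R b c)) (gr x a) \<le> gr x c"
        using R_point[of x a b] R_point[of x b c] that by linarith
    qed
    show "R (meet a b) a = 1" "R (meet a b) b = 1" if "a \<in> A" "b \<in> A" for a b
      using that by (simp_all add: R_one meet)
    show "R a tp = 1" if "a \<in> A" for a
      using that range tp by (simp add: R_one)
    show "min (R a b) (R a c) = R a (meet b c)" if "a \<in> A" "b \<in> A" "c \<in> A" for a b c
    proof -
      have "u \<le> min (R a b) (R a c) \<longleftrightarrow> u \<le> R a (meet b c)" for u
        using that by (auto simp: le_R meet)
      then show ?thesis by (meson order.refl antisym)
    qed
    show "R a (Join S) = 1" if "S \<subseteq> A" "a \<in> S" for S a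
    proof -
      have "a \<in> A" using that by blast
      then show ?thesis
        using that sup01_least_upper_bound(2)[OF grS[OF _ that(1)]] by (simp add: R_one Join)
    qed
    show "inf01 ((\<lambda>a. R a b) ` S) = R (Join S) b" if S: "S \<subseteq> A" and b: "b \<in> A" for S b
    proof -
      have RS: "(\<lambda>a. R a b) ` S \<subseteq> {0..1}" using R_range S b by blast
      have "u \<le> inf01 ((\<lambda>a. R a b) ` S) \<longleftrightarrow> u \<le> R (Join S) b"
        if u: "0 \<le> u" "u \<le> 1" for u
      proof -
        have "min u (gr x (Join S)) \<le> gr x b \<longleftrightarrow> (\<forall>a\<in>S. min u (gr x a) \<le> gr x b)"
          if x: "x \<in> X" for x
        proof -
          have img: "min u ` gr x ` S \<subseteq> {0..1}"
            using grS[OF x S] u by (auto simp: min_le_iff_disj)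
          show ?thesis
            using range[OF x b] u min_sup01[OF _ grS[OF x S], of u]
            by (simp add: Join(2)[OF x S] sup01_le_iff[OF img])
        qed
        moreover have "u \<le> R a b \<longleftrightarrow> (\<forall>x\<in>X. min u (gr x a) \<le> gr x b)" if "a \<in> S" for a
          using le_R[of a b u] that S b u by blast
        ultimately show ?thesis
          using le_R[OF Join(1)[OF S] b, of u] u by (auto simp: le_inf01_iff[OF RS])
      qed
      then show ?thesis
        using inf01_greatest_lower_bound(1)[OF RS] R_range[OF Join(1)[OF S] b]
        by (meson atLeastAtMost_iff order.refl antisym)
    qed
    show "R (meet a (Join S)) (Join (meet a ` S)) = 1" if a: "a \<in> A" and S: "S \<subseteq> A" for a S
    proof -
      have mS: "meet a ` S \<subseteq> A" using meet(1) a S by blast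
      have "gr x (meet a (Join S)) = gr x (Join (meet a ` S))" if x: "x \<in> X" for x
      proof -
        have "gr x ` meet a ` S = min (gr x a) ` gr x ` S"
          unfolding image_image using S a x by (intro image_cong) (auto simp: meet)
        then show ?thesis
          using a x S mS by (simp add: meet(2) Join min_sup01[OF range[OF x a] grS[OF x S]])
      qed
      then show ?thesis using a S mS by (simp add: R_one meet(1) Join(1))
    qed
    show "X \<noteq> {}" by (fact X)
    show "gr x a \<in> {0..1}" if "x \<in> X" "a \<in> A" for x a using that by (fact range)
    show "min (gr x a) (R a b) \<le> gr x b" if "x \<in> X" "a \<in> A" "b \<in> A" for x a b
      using R_point[OF that] by (simp add: min.commute)
    show "gr x (finite_meet tp meet S) = inf01 (gr x ` S)"
      if x: "x \<in> X" and S: "finite S" "S \<subseteq> A" for x S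
    proof -
      \<comment> \<open>The meet need not commute with itself on arguments outside \<open>A\<close>. Replacing it there by a
        projection gives a function that commutes everywhere and has the same fold.\<close>
      define meet' where "meet' a b = (if b \<in> A then meet a b else b)" for a b
      interpret comp_fun_commute_on A meet'
        by unfold_locales (auto simp: meet'_def fun_eq_iff meet(1) intro: meet_left_commute)
      have "finite_meet tp meet S = Finite_Set.fold meet' tp S"
        unfolding finite_meet_def using S tp(1)
        by (intro fold_closed_eq[where B = A]) (auto simp: meet'_def meet(1))
      moreover have "Finite_Set.fold meet' tp S \<in> A \<and>
          gr x (Finite_Set.fold meet' tp S) = inf01 (gr x ` S)"
        using S
      proof (induction S rule: finite_induct)
        case empty
        then show ?case using tp x by (simp add: inf01_def)
      next
        case (insert a T)
        then have "Finite_Set.fold meet' tp (insert a T) = meet' a (Finite_Set.fold meet' tp T)"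
          by (intro fold_insert) auto
        also have "\<dots> = meet a (Finite_Set.fold meet' tp T)"
          using insert by (simp add: meet'_def[of a])
        finally have "Finite_Set.fold meet' tp (insert a T) = meet a (Finite_Set.fold meet' tp T)" .
        with insert x show ?case
          using range[OF x] by (simp add: meet inf01_insert grS)
      qed
      ultimately show ?thesis by simp
    qed
    show "gr x (Join S) = sup01 (gr x ` S)" if "x \<in> X" "S \<subseteq> A" for x S
      using that by (fact Join)
  qed
qed


section \<open>Every geometric formula is a disjunction of finitary ones\<close>

text \<open>The formulae free of disjunctions. As a type of its own, not mentioning the index type \<open>'k\<close> of
  disjunctions, it is countable.\<close>

datatype finitary =
    FTop
  | FBot
  | FPred nat nat "tm list"
  | FEq tm tm
  | FAnd finitary finitary
  | FEx nat finitary

instance tm :: countable by countable_datatype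

instance finitary :: countable by countable_datatype

primrec fm_of_finitary :: "finitary \<Rightarrow> 'k fm" where
  "fm_of_finitary FTop = Top"
| "fm_of_finitary FBot = Bot"
| "fm_of_finitary (FPred i j ts) = Pred i j ts"
| "fm_of_finitary (FEq t u) = Eq t u"
| "fm_of_finitary (FAnd f g) = And (fm_of_finitary f) (fm_of_finitary g)"
| "fm_of_finitary (FEx n f) = Ex n (fm_of_finitary f)"

lemma tm_val_in_Dom:
  assumes J: "is_interpretation L J" and s: "s \<in> assignments J" and t: "t \<in> terms L"
  shows "tm_val J s t \<in> Dom J"
  using t
proof induction
  case (3 i j ts)
  then have "set (map (tm_val J s) ts) \<subseteq> Dom J" by auto
  with 3 J show ?case by (simp add: is_interpretation_def)
qed (use J s in \<open>auto simp: is_interpretation_def assignments_def\<close>)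

lemma assignments_upd: "s \<in> assignments J \<Longrightarrow> d \<in> Dom J \<Longrightarrow> s(n := d) \<in> assignments J"
  by (simp add: assignments_def)

lemma grade_range:
  assumes J: "is_interpretation L J" and \<phi>: "\<phi> \<in> formulae L" and s: "s \<in> assignments J"
  shows "grade J \<phi> s \<in> {0..1}"
  using \<phi> s
proof (induction arbitrary: s)
  case (3 i j ts)
  then have "set (map (tm_val J s) ts) \<subseteq> Dom J"
    using tm_val_in_Dom[OF J] by auto
  with 3 J show ?case by (simp add: is_interpretation_def del: atLeastAtMost_iff)
next
  case (6 F I)
  then show ?case
    by (simp del: atLeastAtMost_iff) (intro sup01_least_upper_bound(1) image_subsetI)
next
  case (7 \<phi> n)
  then show ?case
    by (simp del: atLeastAtMost_iff)
      (intro sup01_least_upper_bound(1) image_subsetI 7 assignments_upd)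
qed (auto simp: min_le_iff_disj)

text \<open>Finitary formulae are closed under conjunction and existential quantification, so it is enough
  to move suprema outwards: past a minimum by distributivity in each argument, past the supremum of
  a quantifier or of a disjunction by interchanging or merging suprema. Quantifiers stay where they are
  inside conjunctions, which avoids any renaming of bound variables.\<close>

lemma grade_eq_sup_of_finitary:
  fixes \<phi> :: "'k fm"
  assumes J: "is_interpretation L J" and \<phi>: "\<phi> \<in> formulae L"
  shows "\<exists>T. (\<forall>f\<in>T. (fm_of_finitary f :: 'k fm) \<in> formulae L) \<and>
    (\<forall>s\<in>assignments J. grade J \<phi> s = sup01 ((\<lambda>f. grade J (fm_of_finitary f :: 'k fm) s) ` T))"
proof -
  define gf where "gf s f = grade J (fm_of_finitary f :: 'k fm) s" for s f
  define nf where "nf \<phi> T \<longleftrightarrow> (\<forall>f\<in>T. (fm_of_finitary f :: 'k fm) \<in> formulae L) \<and>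
    (\<forall>s\<in>assignments J. grade J \<phi> s = sup01 (gf s ` T))" for \<phi> :: "'k fm" and T
  have gf_range: "gf s f \<in> {0..1}"
    if "nf \<phi> T" "f \<in> T" "s \<in> assignments J" for \<phi> T f s
    using that grade_range[OF J] unfolding nf_def gf_def by blast
  have sing: "nf (fm_of_finitary f) {f}" if "(fm_of_finitary f :: 'k fm) \<in> formulae L" for f
    using that grade_range[OF J that] by (auto simp: nf_def gf_def sup01_def cSup_eq_Max)
  have "\<exists>T. nf \<phi> T"
    using \<phi>
  proof induction
    case 1
    then show ?case using sing[of FTop] by (auto intro: formulae.intros)
  next
    case 2
    then show ?case using sing[of FBot] by (auto intro: formulae.intros)
  next
    case (3 i j ts)
    then show ?case using sing[of "FPred i j ts"] by (auto intro: formulae.intros)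
  next
    case (4 t u)
    then show ?case using sing[of "FEq t u"] by (auto intro: formulae.intros)
  next
    case (5 \<phi> \<psi>)
    then obtain T U where T: "nf \<phi> T" and U: "nf \<psi> U" by blast
    have "nf (And \<phi> \<psi>) (\<Union>f\<in>T. FAnd f ` U)"
      unfolding nf_def
    proof (intro conjI ballI)
      fix h assume "h \<in> (\<Union>f\<in>T. FAnd f ` U)"
      then show "(fm_of_finitary h :: 'k fm) \<in> formulae L"
        using T U by (auto simp: nf_def intro!: formulae.intros(5))
    next
      fix s assume s: "s \<in> assignments J"
      have gT: "gf s ` T \<subseteq> {0..1}" and gU: "gf s ` U \<subseteq> {0..1}"
        using gf_range T U s by blast+
      have "grade J (And \<phi> \<psi>) s = min (sup01 (gf s ` U)) (sup01 (gf s ` T))"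
        using T U s by (simp add: nf_def min.commute)
      also have "\<dots> = sup01 ((\<lambda>f. min (gf s f) (sup01 (gf s ` U))) ` T)"
        using min_sup01[OF sup01_least_upper_bound(1)[OF gU] gT] by (simp add: image_image min.commute)
      also have "\<dots> = sup01 ((\<lambda>f. sup01 (gf s ` FAnd f ` U)) ` T)"
      proof (intro arg_cong[where f = sup01] image_cong refl)
        fix f assume "f \<in> T"
        then show "min (gf s f) (sup01 (gf s ` U)) = sup01 (gf s ` FAnd f ` U)"
          using min_sup01[OF gf_range[OF T _ s] gU] by (simp add: image_image gf_def)
      qed
      also have "\<dots> = sup01 (gf s ` (\<Union>f\<in>T. FAnd f ` U))"
      proof (rule sup01_sup01_UN)
        fix f h assume "f \<in> T" "h \<in> FAnd f ` U"
        then obtain g where "h = FAnd f g" "gf s f \<in> {0..1}" "gf s g \<in> {0..1}"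
          using gf_range T U s by blast
        then show "gf s h \<in> {0..1}" by (simp add: gf_def min_le_iff_disj)
      qed
      finally show "grade J (And \<phi> \<psi>) s = sup01 (gf s ` (\<Union>f\<in>T. FAnd f ` U))" .
    qed
    then show ?case by blast
  next
    case (6 F I)
    then obtain T where T: "\<And>k. k \<in> I \<Longrightarrow> nf (F k) (T k)" by metis
    have "nf (Disj I F) (\<Union>k\<in>I. T k)"
      unfolding nf_def
    proof (intro conjI ballI)
      fix h assume "h \<in> (\<Union>k\<in>I. T k)"
      then show "(fm_of_finitary h :: 'k fm) \<in> formulae L"
        using T by (auto simp: nf_def)
    next
      fix s assume s: "s \<in> assignments J"
      then have "grade J (Disj I F) s = sup01 ((\<lambda>k. sup01 (gf s ` T k)) ` I)"
        using T by (simp add: nf_def cong: image_cong)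
      also have "\<dots> = sup01 (gf s ` (\<Union>k\<in>I. T k))"
        using gf_range[OF T _ s] by (rule sup01_sup01_UN)
      finally show "grade J (Disj I F) s = sup01 (gf s ` (\<Union>k\<in>I. T k))" .
    qed
    then show ?case by blast
  next
    case (7 \<phi> n)
    then obtain T where T: "nf \<phi> T" by blast
    have "nf (Ex n \<phi>) (FEx n ` T)"
      unfolding nf_def
    proof (intro conjI ballI)
      fix h assume "h \<in> FEx n ` T"
      then show "(fm_of_finitary h :: 'k fm) \<in> formulae L"
        using T by (auto simp: nf_def intro!: formulae.intros(7))
    next
      fix s assume s: "s \<in> assignments J"
      have upd: "s(n := d) \<in> assignments J" if "d \<in> Dom J" for d
        using s that by (rule assignments_upd)
      have "grade J (Ex n \<phi>) s = sup01 ((\<lambda>d. sup01 (gf (s(n := d)) ` T)) ` Dom J)"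
      proof (simp only: grade.simps, intro arg_cong[where f = sup01] image_cong refl)
        fix d assume "d \<in> Dom J"
        with T upd show "grade J \<phi> (s(n := d)) = sup01 (gf (s(n := d)) ` T)"
          unfolding nf_def by blast
      qed
      also have "\<dots> = sup01 ((\<lambda>f. sup01 ((\<lambda>d. gf (s(n := d)) f) ` Dom J)) ` T)"
        using gf_range[OF T _ upd] by (intro sup01_commute)
      also have "\<dots> = sup01 (gf s ` FEx n ` T)"
        by (simp add: gf_def image_image)
      finally show "grade J (Ex n \<phi>) s = sup01 (gf s ` FEx n ` T)" .
    qed
    then show ?case by blast
  qed
  then show ?thesis unfolding nf_def gf_def .
qed


section \<open>Classes of formulae\<close>

lemma fm_class_in_quotient: "\<phi> \<in> formulae L \<Longrightarrow> fm_class L J \<phi> \<in> fm_quotient L J"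
  by (simp add: fm_class_def fm_quotient_def quotientI)

lemma fm_quotient_cases:
  assumes "a \<in> fm_quotient L J"
  obtains \<phi> where "\<phi> \<in> formulae L" "a = fm_class L J \<phi>"
  using assms unfolding fm_quotient_def fm_class_def by (rule quotientE)

lemma class_grade_separating:
  assumes "a \<in> fm_quotient L J" "b \<in> fm_quotient L J"
    and "\<And>s. s \<in> assignments J \<Longrightarrow> class_grade J s a = class_grade J s b"
  shows "a = b"
proof -
  obtain \<phi> \<psi> where "\<phi> \<in> formulae L" "a = fm_class L J \<phi>" "\<psi> \<in> formulae L" "b = fm_class L J \<psi>"
    using assms(1,2) by (metis fm_quotient_cases)
  with assms(3) show ?thesis by (simp add: fm_class_eq_iff class_grade_fm_class)
qed

text \<open>A class is determined by any set of finitary formulae of which it is the disjunction.\<close>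

lemma fm_quotient_lepoll_continuum:
  assumes J: "is_interpretation L J"
  shows "(fm_quotient L J :: 'k fm set set) \<lesssim> (UNIV :: nat set set)"
proof -
  have "\<forall>a\<in>fm_quotient L J :: 'k fm set set. \<exists>T. \<forall>s\<in>assignments J.
      class_grade J s a = sup01 ((\<lambda>f. grade J (fm_of_finitary f :: 'k fm) s) ` T)"
  proof
    fix a :: "'k fm set" assume "a \<in> fm_quotient L J"
    then obtain \<phi> where \<phi>: "\<phi> \<in> formulae L" "a = fm_class L J \<phi>"
      by (rule fm_quotient_cases)
    show "\<exists>T. \<forall>s\<in>assignments J.
        class_grade J s a = sup01 ((\<lambda>f. grade J (fm_of_finitary f :: 'k fm) s) ` T)"
      using grade_eq_sup_of_finitary[OF J \<phi>(1)] by (auto simp: \<phi> class_grade_fm_class)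
  qed
  then obtain T :: "'k fm set \<Rightarrow> finitary set" where
    T: "\<forall>a\<in>fm_quotient L J. \<forall>s\<in>assignments J.
      class_grade J s a = sup01 ((\<lambda>f. grade J (fm_of_finitary f :: 'k fm) s) ` T a)"
    by (rule bchoice[THEN exE])
  have "inj_on (\<lambda>a. to_nat ` T a) (fm_quotient L J)"
  proof (rule inj_onI)
    fix a b :: "'k fm set"
    assume ab: "a \<in> fm_quotient L J" "b \<in> fm_quotient L J" and "to_nat ` T a = to_nat ` T b"
    then have "T a = T b" by (simp add: inj_image_eq_iff)
    with ab T show "a = b" by (intro class_grade_separating) auto
  qed
  then show ?thesis unfolding lepoll_def by blast
qed

lemma class_meet:
  assumes "a \<in> fm_quotient L J" "b \<in> fm_quotient L J"
  shows "class_meet L J a b \<in> fm_quotient L J"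
    and "s \<in> assignments J \<Longrightarrow>
      class_grade J s (class_meet L J a b) = min (class_grade J s a) (class_grade J s b)"
proof -
  obtain \<phi> \<psi> where *: "\<phi> \<in> formulae L" "a = fm_class L J \<phi>" "\<psi> \<in> formulae L" "b = fm_class L J \<psi>"
    using assms by (metis fm_quotient_cases)
  then have "And \<phi> \<psi> \<in> formulae L" by (intro formulae.intros)
  then show "class_meet L J a b \<in> fm_quotient L J"
    and "s \<in> assignments J \<Longrightarrow>
      class_grade J s (class_meet L J a b) = min (class_grade J s a) (class_grade J s b)"
    using * by (simp_all add: class_meet_fm_class fm_class_in_quotient class_grade_fm_class)
qed

text \<open>This is where the size of the index type enters: a set of classes is the range of a family of
  classes over a subset of \<open>'k\<close>, namely over its own image under an injection into \<open>'k\<close>.\<close>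

lemma class_Join:
  fixes S :: "'k fm set set"
  assumes small: "(fm_quotient L J :: 'k fm set set) \<lesssim> (UNIV :: 'k set)"
    and S: "S \<subseteq> fm_quotient L J"
  shows "class_Join L J S \<in> fm_quotient L J"
    and "s \<in> assignments J \<Longrightarrow> class_grade J s (class_Join L J S) = sup01 (class_grade J s ` S)"
proof -
  obtain e :: "'k fm set \<Rightarrow> 'k" where "inj_on e (fm_quotient L J)"
    using small unfolding lepoll_def by blast
  then have e: "inj_on e S" using S by (rule inj_on_subset)
  have "\<forall>a\<in>S. \<exists>\<phi>. \<phi> \<in> formulae L \<and> a = fm_class L J \<phi>"
    using S by (meson fm_quotient_cases subsetD)
  then obtain rep where rep: "\<And>a. a \<in> S \<Longrightarrow> rep a \<in> formulae L \<and> a = fm_class L J (rep a)"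
    by metis
  define F where "F = restrict (rep \<circ> the_inv_into S e) (e ` S)"
  have Fe: "F (e a) = rep a" if "a \<in> S" for a
    using that e by (simp add: F_def the_inv_into_f_f)
  have F: "F \<in> e ` S \<rightarrow>\<^sub>E formulae L"
    using rep Fe by (intro PiE_I) (auto simp: F_def)
  have classes: "(\<lambda>k. fm_class L J (F k)) ` e ` S = S"
    using rep Fe by (simp add: image_image cong: image_cong)
  have Join: "class_Join L J S = fm_class L J (Disj (e ` S) F)"
    using class_Join_fm_class[OF F, of J] unfolding classes .
  then show "class_Join L J S \<in> fm_quotient L J"
    using Disj_in_formulae[OF F] by (simp add: fm_class_in_quotient)
  assume s: "s \<in> assignments J"
  have "(\<lambda>a. grade J (F (e a)) s) ` S = class_grade J s ` S"
  proof (intro image_cong refl)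
    fix a assume a: "a \<in> S"
    then have "class_grade J s (fm_class L J (rep a)) = grade J (rep a) s"
      using rep s by (intro class_grade_fm_class) auto
    then show "grade J (F (e a)) s = class_grade J s a"
      using a rep Fe by simp
  qed
  then show "class_grade J s (class_Join L J S) = sup01 (class_grade J s ` S)"
    using Disj_in_formulae[OF F] s by (simp add: Join class_grade_fm_class image_image)
qed

theorem theorem6p7p2:
  fixes L :: language and J :: "'d interp"
  assumes "is_interpretation L J"
    and "(UNIV :: nat set set) \<lesssim> (UNIV :: 'k set)"
  shows "graded_fuzzy_topological_system (assignments J) (class_grade J)
    (fm_quotient L J :: 'k fm set set) (fm_class L J Top)
    (class_meet L J) (class_Join L J) (class_R J)"
proof (rule graded_system_of_separating_evaluation)
  note J = assms(1)
  have small: "(fm_quotient L J :: 'k fm set set) \<lesssim> (UNIV :: 'k set)"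
    using fm_quotient_lepoll_continuum[OF J] assms(2) by (rule lepoll_trans)
  have Top: "(Top :: 'k fm) \<in> formulae L" by (rule formulae.intros)
  show "assignments J \<noteq> {}"
  proof -
    obtain d where "d \<in> Dom J" using J by (auto simp: is_interpretation_def)
    then have "(\<lambda>_. d) \<in> assignments J" by (simp add: assignments_def)
    then show ?thesis by blast
  qed
  show "class_grade J s a \<in> {0..1}"
    if "s \<in> assignments J" "a \<in> fm_quotient L J" for s and a :: "'k fm set"
    using that(2)
  proof (rule fm_quotient_cases)
    fix \<phi> assume "\<phi> \<in> formulae L" "a = fm_class L J \<phi>"
    then show ?thesis
      using grade_range[OF J _ that(1)] that(1) by (simp add: class_grade_fm_class)
  qed
  show "a = b" if "a \<in> fm_quotient L J" "b \<in> fm_quotient L J"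
    "\<And>s. s \<in> assignments J \<Longrightarrow> class_grade J s a = class_grade J s b" for a b :: "'k fm set"
    using that by (rule class_grade_separating)
  show "(fm_class L J Top :: 'k fm set) \<in> fm_quotient L J"
    using Top by (rule fm_class_in_quotient)
  show "class_grade J s (fm_class L J Top :: 'k fm set) = 1" if "s \<in> assignments J" for s
    using class_grade_fm_class[OF Top that] by simp
  show "class_R J a b = inf01 ((\<lambda>s. godel_arrow (class_grade J s a) (class_grade J s b)) ` assignments J)"
    for a b :: "'k fm set"
    by (rule class_R_def)
  show "class_meet L J a b \<in> fm_quotient L J"
    if "a \<in> fm_quotient L J" "b \<in> fm_quotient L J" for a b :: "'k fm set"
    using that by (rule class_meet)
  show "class_grade J s (class_meet L J a b) = min (class_grade J s a) (class_grade J s b)"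
    if "s \<in> assignments J" "a \<in> fm_quotient L J" "b \<in> fm_quotient L J"
    for s and a b :: "'k fm set"
    using that(2,3,1) by (rule class_meet)
  show "class_Join L J S \<in> fm_quotient L J"
    if "S \<subseteq> fm_quotient L J" for S :: "'k fm set set"
    using small that by (rule class_Join)
  show "class_grade J s (class_Join L J S) = sup01 (class_grade J s ` S)"
    if "s \<in> assignments J" "S \<subseteq> fm_quotient L J" for s and S :: "'k fm set set"
    using small that(2,1) by (rule class_Join)
qed

end
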